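(* Let $D=(0,1)$, $T>0$, and let $a,b:[0,T]\times[0,1]\to\mathbb{R}$ with $a(t,x)>0$ for all $(t,x)\in[0,T]\times[0,1]$. Suppose that $$\int_0^x\frac{a(b_t-a_{xt})-a_t(b-a_x)}{a^2}(t,y)\,dy=0\qquad\text{for all }(t,x)\in[0,T]\times[0,1].$$ Then the periodic problem $$\begin{cases}\partial_tp(t,x)-(a(t,x)p(t,x))_{xx}+(b(t,x)p(t,x))_x=0 & \text{in } D\times(0,T],\\ (a(t,x)p(t,x))_x-b(t,x)p(t,x)=0 & \text{on }\partial D\times(0,T],\\ p(0,x)=p(T,x) & \text{in } D\end{cases}$$ admits the solution $$p(t,x)=\exp\left(\int_0^x\frac{b-a_x}{a}(t,y)\,dy\right).$$
   Context: Subscripts $t$ and $x$ denote partial derivatives. The coefficients $a$ and $b$ are assumed regular enough that the derivatives $a_t,a_x,a_{xt},b_t$ appearing in the statement exist and are continuous on $[0,T]\times[0,1]$. (In the paper $a=\sigma\sigma^T$ is the diffusion coefficient and $b$ the drift of a one-dimensional SDE with reflecting boundary.)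
   Formalization: The drift b is additionally assumed continuous on [0,T]×[0,1] and differentiable in x at every interior x for t in (0,T]; without this the boundary condition can fail or (bp)_x need not exist. "Solution" is read as a classical pointwise solution. *)

theory Defs
  imports "HOL-Analysis.Analysis"
begin

(* Functions of (t, x) on the closed cylinder [0,T] x [0,1] are curried maps
   real => real => real. Their values off the cylinder are irrelevant: derivatives are taken
   within {0..T} in t and within {0..1} in x, so they are one-sided on the edges and two-sided
   (and unique) elsewhere. S is the set of points at which the derivative is required to exist. *)

definition has_partial_t_on ::
    "real \<Rightarrow> (real \<Rightarrow> real \<Rightarrow> real) \<Rightarrow> (real \<Rightarrow> real \<Rightarrow> real) \<Rightarrow> (real \<times> real) set \<Rightarrow> bool" where
  "has_partial_t_on T f f' S \<longleftrightarrow>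
     (\<forall>(t, x)\<in>S. ((\<lambda>s. f s x) has_real_derivative f' t x) (at t within {0..T}))"

definition has_partial_x_on ::
    "(real \<Rightarrow> real \<Rightarrow> real) \<Rightarrow> (real \<Rightarrow> real \<Rightarrow> real) \<Rightarrow> (real \<times> real) set \<Rightarrow> bool" where
  "has_partial_x_on f f' S \<longleftrightarrow>
     (\<forall>(t, x)\<in>S. ((\<lambda>y. f t y) has_real_derivative f' t x) (at x within {0..1}))"

(* Classical solution: every derivative in the problem exists pointwise where it is used.
   ap_x, ap_xx and bp_x stand for (a p)_x, (a p)_xx and (b p)_x; ap_x is required up to x = 0, 1
   because it occurs in the boundary condition. Continuity of p on the closed cylinder ties the
   values at t = 0 in the periodicity condition to the equation, which is posed for t > 0 only. *)
definition periodic_solution ::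
    "real \<Rightarrow> (real \<Rightarrow> real \<Rightarrow> real) \<Rightarrow> (real \<Rightarrow> real \<Rightarrow> real) \<Rightarrow> (real \<Rightarrow> real \<Rightarrow> real) \<Rightarrow> bool" where
  "periodic_solution T a b p \<longleftrightarrow>
     continuous_on ({0..T} \<times> {0..1}) (\<lambda>(t, x). p t x) \<and>
     (\<exists>p_t ap_x ap_xx bp_x.
        has_partial_t_on T p p_t ({0<..T} \<times> {0<..<1}) \<and>
        has_partial_x_on (\<lambda>t x. a t x * p t x) ap_x ({0<..T} \<times> {0..1}) \<and>
        has_partial_x_on ap_x ap_xx ({0<..T} \<times> {0<..<1}) \<and>
        has_partial_x_on (\<lambda>t x. b t x * p t x) bp_x ({0<..T} \<times> {0<..<1}) \<and>
        (\<forall>t\<in>{0<..T}. \<forall>x\<in>{0<..<1}. p_t t x - ap_xx t x + bp_x t x = 0) \<and>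
        (\<forall>t\<in>{0<..T}. \<forall>x\<in>{0, 1}. ap_x t x - b t x * p t x = 0)) \<and>
     (\<forall>x\<in>{0<..<1}. p 0 x = p T x)"

end

theory Submission
  imports Defs
begin

text \<open>
  Let \<open>g = (b - a_x) / a\<close> be the logarithmic \<open>x\<close>-derivative of the candidate \<open>p\<close>. It is chosen
  such that \<open>(a p)_x = a_x p + a g p = b p\<close>, that is, such that the probability flux
  \<open>(a p)_x - b p\<close> vanishes on the whole closed interval and not only at its ends. The boundary
  condition is then immediate, and the equation reduces to \<open>p_t = 0\<close>.

  By the quotient rule, the integrand in the compatibility hypothesis is exactly \<open>g_t\<close>. As all
  its integrals over \<open>[0, x]\<close> vanish and it is continuous in \<open>x\<close>, it vanishes identically
  (\<open>continuous_zero_of_integrals_zero\<close>). Hence neither \<open>g\<close> nor \<open>p\<close> depends on time, which gives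
  both \<open>p_t = 0\<close> and periodicity. Arguing pointwise in this way avoids differentiating under the
  integral sign, and reduces joint continuity of \<open>p\<close> to continuity in \<open>x\<close>.
\<close>

text \<open>
  The two values \<open>f y\<close> and \<open>0\<close> are both derivatives at \<open>y\<close> of the indefinite integral. The
  derivative within a nondegenerate interval is unique, also at the end points.
\<close>

lemma continuous_zero_of_integrals_zero:
  fixes f :: "real \<Rightarrow> real"
  assumes "c < d" and cont: "continuous_on {c..d} f"
    and zero: "\<And>x. x \<in> {c..d} \<Longrightarrow> integral {c..x} f = 0"
    and y: "y \<in> {c..d}"
  shows "f y = 0"
proof -
  have "((\<lambda>x. integral {c..x} f) has_vector_derivative f y) (at y within {c..d})"
    by (rule integral_has_vector_derivative[OF cont y])
  moreover have "((\<lambda>x. integral {c..x} f) has_vector_derivative 0) (at y within {c..d})"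
    by (rule has_vector_derivative_transform[OF y _ has_vector_derivative_const[of 0]])
       (simp add: zero)
  ultimately show ?thesis
    using vector_derivative_unique_within_closed_interval[of c d y] \<open>c < d\<close> y by simp
qed

lemma continuous_on_section:
  assumes "continuous_on (A \<times> B) (\<lambda>(t, x). f t x)" and "t \<in> A"
  shows "continuous_on B (f t)"
proof -
  have "continuous_on B (\<lambda>x. (\<lambda>(t, x). f t x) (t, x))"
    by (rule continuous_on_compose2[OF assms(1)]) (auto intro!: continuous_intros assms(2))
  then show ?thesis by simp
qed

theorem theorem4p3:
  fixes T :: real
    and a b a_t a_x a_xt b_t :: "real \<Rightarrow> real \<Rightarrow> real"
  assumes "T > 0"
    and "\<And>t x. t \<in> {0..T} \<Longrightarrow> x \<in> {0..1} \<Longrightarrow> a t x > 0"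
    and "has_partial_t_on T a a_t ({0..T} \<times> {0..1})"
    and "has_partial_x_on a a_x ({0..T} \<times> {0..1})"
    and "has_partial_t_on T a_x a_xt ({0..T} \<times> {0..1})"
    and "has_partial_t_on T b b_t ({0..T} \<times> {0..1})"
    and "continuous_on ({0..T} \<times> {0..1}) (\<lambda>(t, x). a_t t x)"
    and "continuous_on ({0..T} \<times> {0..1}) (\<lambda>(t, x). a_x t x)"
    and "continuous_on ({0..T} \<times> {0..1}) (\<lambda>(t, x). a_xt t x)"
    and "continuous_on ({0..T} \<times> {0..1}) (\<lambda>(t, x). b_t t x)"
    and "continuous_on ({0..T} \<times> {0..1}) (\<lambda>(t, x). b t x)"
    and "\<And>t x. t \<in> {0<..T} \<Longrightarrow> x \<in> {0<..<1} \<Longrightarrow> (\<lambda>y. b t y) differentiable (at x)"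
    and "\<And>t x. t \<in> {0..T} \<Longrightarrow> x \<in> {0..1} \<Longrightarrow>
           integral {0..x} (\<lambda>y. (a t y * (b_t t y - a_xt t y) - a_t t y * (b t y - a_x t y))
                                  / (a t y)\<^sup>2) = 0"
  shows "periodic_solution T a b
           (\<lambda>t x. exp (integral {0..x} (\<lambda>y. (b t y - a_x t y) / a t y)))"
proof -
  note a_pos = assms(2)
  define g where "g t x = (b t x - a_x t x) / a t x" for t x
  define g_t where
    "g_t t y = (a t y * (b_t t y - a_xt t y) - a_t t y * (b t y - a_x t y)) / (a t y)\<^sup>2" for t y
  define p where "p t x = exp (integral {0..x} (g t))" for t x
  have a_dx: "(a t has_real_derivative a_x t x) (at x within {0..1})"
    if "t \<in> {0..T}" "x \<in> {0..1}" for t x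
    using assms(4) that by (auto simp: has_partial_x_on_def)
  have a_cont: "continuous_on {0..1} (a t)" if "t \<in> {0..T}" for t
    using a_dx[OF that] by (intro DERIV_continuous_on) auto
  note sections = assms(7-11)[THEN continuous_on_section]
  have g_cont: "continuous_on {0..1} (g t)" if "t \<in> {0..T}" for t
    unfolding g_def using a_pos[OF that]
    by (intro continuous_intros a_cont sections that) force
  have g_t_cont: "continuous_on {0..1} (g_t t)" if "t \<in> {0..T}" for t
    unfolding g_t_def using a_pos[OF that]
    by (intro continuous_intros a_cont sections that) force

  have g_dt: "((\<lambda>s. g s x) has_real_derivative g_t t x) (at t within {0..T})"
    if "t \<in> {0..T}" "x \<in> {0..1}" for t x
  proof -
    have "((\<lambda>s. a s x) has_real_derivative a_t t x) (at t within {0..T})"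
      and "((\<lambda>s. a_x s x) has_real_derivative a_xt t x) (at t within {0..T})"
      and "((\<lambda>s. b s x) has_real_derivative b_t t x) (at t within {0..T})"
      using assms(3,5,6) that by (auto simp: has_partial_t_on_def)
    then show ?thesis
      unfolding g_def g_t_def using a_pos[OF that]
      by (auto intro!: derivative_eq_intros simp: power2_eq_square algebra_simps)
  qed
  have g_t_zero: "g_t t x = 0" if "t \<in> {0..T}" "x \<in> {0..1}" for t x
    using assms(13)[OF that(1)] that
    by (intro continuous_zero_of_integrals_zero[OF _ g_t_cont]) (auto simp: g_t_def[abs_def])
  have g_const: "g t x = g 0 x" if "t \<in> {0..T}" "x \<in> {0..1}" for t x
  proof -
    have "((\<lambda>s. g s x) has_real_derivative 0) (at s within {0..T})" if "s \<in> {0..T}" for s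
      using g_dt[of s x] g_t_zero[of s x] that \<open>x \<in> {0..1}\<close> by simp
    then obtain c where "\<And>s. s \<in> {0..T} \<Longrightarrow> g s x = c"
      using has_field_derivative_zero_constant[of "{0..T}" "\<lambda>s. g s x"] by auto
    then show ?thesis using that(1) \<open>T > 0\<close> by simp
  qed
  have p_const: "p t x = p 0 x" if "t \<in> {0..T}" "x \<in> {0..1}" for t x
    unfolding p_def using that by (intro arg_cong[where f = exp] integral_cong g_const) auto

  have p_dx: "(p t has_real_derivative g t x * p t x) (at x within {0..1})"
    if "t \<in> {0..T}" "x \<in> {0..1}" for t x
    unfolding p_def using integral_has_real_derivative[OF g_cont[OF that(1)] that(2)]
    by (auto intro!: derivative_eq_intros)
  have flux: "((\<lambda>y. a t y * p t y) has_real_derivative b t x * p t x) (at x within {0..1})"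
    if "t \<in> {0..T}" "x \<in> {0..1}" for t x
  proof -
    have "a_x t x * p t x + g t x * p t x * a t x = b t x * p t x"
      using a_pos[OF that] by (simp add: g_def field_simps)
    then show ?thesis
      using DERIV_mult[OF a_dx[OF that] p_dx[OF that]] by simp
  qed
  define bp_x where "bp_x t x = deriv (b t) x * p t x + g t x * p t x * b t x" for t x
  have bp_dx: "((\<lambda>y. b t y * p t y) has_real_derivative bp_x t x) (at x within {0..1})"
    if "t \<in> {0<..T}" "x \<in> {0<..<1}" for t x
  proof -
    have "(b t has_real_derivative deriv (b t) x) (at x within {0..1})"
      using assms(12)[OF that]
      by (metis DERIV_deriv_iff_real_differentiable has_field_derivative_at_within)
    then show ?thesis
      unfolding bp_x_def using p_dx[of t x] that by (intro DERIV_mult) auto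
  qed
  have p_dt: "((\<lambda>s. p s x) has_real_derivative 0) (at t within {0..T})"
    if "t \<in> {0..T}" "x \<in> {0..1}" for t x
    by (rule has_field_derivative_transform_within[OF DERIV_const[of "p 0 x"] zero_less_one that(1)])
       (rule p_const[symmetric, OF _ that(2)])

  have "continuous_on {0..1} (p 0)"
    using p_dx[of 0] \<open>T > 0\<close> by (intro DERIV_continuous_on) auto
  then have "continuous_on ({0..T} \<times> {0..1}) (\<lambda>z. p 0 (snd z))"
    by (rule continuous_on_compose2) (auto intro!: continuous_intros)
  then have p_cont: "continuous_on ({0..T} \<times> {0..1}) (\<lambda>(t, x). p t x)"
    by (rule continuous_on_eq, clarsimp) (rule p_const[symmetric], auto)

  have "periodic_solution T a b p"
    unfolding periodic_solution_def has_partial_t_on_def has_partial_x_on_def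
  proof (intro conjI)
    \<comment> \<open>As the flux vanishes, \<open>b p\<close> serves as \<open>(a p)_x\<close>, and \<open>(a p)_xx\<close> coincides with \<open>(b p)_x\<close>.\<close>
    show "\<exists>p_t ap_x ap_xx bp_x.
        (\<forall>(t, x)\<in>{0<..T} \<times> {0<..<1}.
           ((\<lambda>s. p s x) has_real_derivative p_t t x) (at t within {0..T})) \<and>
        (\<forall>(t, x)\<in>{0<..T} \<times> {0..1}.
           ((\<lambda>y. a t y * p t y) has_real_derivative ap_x t x) (at x within {0..1})) \<and>
        (\<forall>(t, x)\<in>{0<..T} \<times> {0<..<1}.
           ((\<lambda>y. ap_x t y) has_real_derivative ap_xx t x) (at x within {0..1})) \<and>
        (\<forall>(t, x)\<in>{0<..T} \<times> {0<..<1}.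
           ((\<lambda>y. b t y * p t y) has_real_derivative bp_x t x) (at x within {0..1})) \<and>
        (\<forall>t\<in>{0<..T}. \<forall>x\<in>{0<..<1}. p_t t x - ap_xx t x + bp_x t x = 0) \<and>
        (\<forall>t\<in>{0<..T}. \<forall>x\<in>{0, 1}. ap_x t x - b t x * p t x = 0)"
      by (rule exI[of _ "\<lambda>t x. 0"], rule exI[of _ "\<lambda>t x. b t x * p t x"],
          rule exI[of _ bp_x], rule exI[of _ bp_x])
         (auto intro!: p_dt flux bp_dx)
    show "\<forall>x\<in>{0<..<1}. p 0 x = p T x"
      using p_const[of T] \<open>T > 0\<close> by auto
  qed (rule p_cont)
  then show ?thesis
    by (simp add: p_def[abs_def] g_def[abs_def])
qed

end
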